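(* Let $C\subseteq\mathbb{R}^n$ be a convex set and let $f:C\to\mathbb{R}$ be continuously differentiable. Let $\bar x\in C$ be nonstationary, i.e. there exists $d\in T_C(\bar x)$ with $\nabla f(\bar x)^Td<0$, and suppose that $T_C(\bar x)$ is polyhedral. Let $\Gamma(\bar x)$ be a set of feasible search paths at $\bar x$ such that $\operatorname{cone}(D)=T_C(\bar x)$, where $D=\{\gamma'(0)\mid\gamma\in\Gamma(\bar x)\}$. Then, for any $\sigma>0$, there exist $\gamma\in\Gamma(\bar x)$ and $\bar t>0$ such that for all $t\in(0,\bar t]$ we have $$f(\gamma(t))-f(\gamma(0))<-\sigma t^2<0.$$
   Context: Continuous differentiability of $f:C\to\mathbb{R}$ means that there is a continuous map $\nabla f:C\to\mathbb{R}^n$ with $f(y)=f(x)+\nabla f(x)^T(y-x)+o(\|y-x\|)$ as $y\to x$, $y\in C$, for each $x\in C$. Tangent cone. For $x\in C$, $T_C(x)=\{0\}\cup\{y\in\mathbb{R}^n\setminus\{0\}\mid \exists\{x^k\}\subseteq C\setminus\{x\}\text{ with }x^k\to x\text{ and }\frac{x^k-x}{\|x^k-x\|}\to\frac{y}{\|y\|}\}$. For a set of directions $D\subseteq\mathbb{R}^n$, $\operatorname{cone}(D)$ is the set of all finite linear combinations of elements of $D$ with nonnegative coefficients. Feasible search path at $x\in C$: a continuous curve $\gamma:\mathbb{R}_+\to C$ ($\mathbb{R}_+=[0,\infty)$) with $\gamma(0)=x$ that is (one-sidedly) differentiable at $t=0$, with derivative (initial velocity) $\gamma'(0)$. *)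

theory Defs
  imports "HOL-Analysis.Analysis"
begin

(* "f is continuously differentiable on C with gradient map g".  The first-order expansion is
   relative to C, so C need not be open.  If C is not full-dimensional, g is not determined by f
   and is therefore carried as an explicit argument. *)
definition has_continuous_gradient_on ::
    "(real ^ 'n \<Rightarrow> real) \<Rightarrow> (real ^ 'n \<Rightarrow> real ^ 'n) \<Rightarrow> (real ^ 'n) set \<Rightarrow> bool" where
  "has_continuous_gradient_on f g C \<longleftrightarrow>
     continuous_on C g \<and>
     (\<forall>x\<in>C. (f has_derivative (\<lambda>h. g x \<bullet> h)) (at x within C))"

definition tangent_cone :: "(real ^ 'n) set \<Rightarrow> real ^ 'n \<Rightarrow> (real ^ 'n) set" where
  "tangent_cone C x =
     {0} \<union> {y. y \<noteq> 0 \<and>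
       (\<exists>X :: nat \<Rightarrow> real ^ 'n.
          (\<forall>k. X k \<in> C - {x}) \<and> X \<longlonglongrightarrow> x \<and>
          (\<lambda>k. (X k - x) /\<^sub>R norm (X k - x)) \<longlonglongrightarrow> y /\<^sub>R norm y)}"

(* The empty combination is included, so the cone generated by the empty set is {0};
   the library's cone hull takes no sums. *)
definition generated_cone :: "(real ^ 'n) set \<Rightarrow> (real ^ 'n) set" where
  "generated_cone D =
     {\<Sum>v\<in>S. c v *\<^sub>R v | S c. finite S \<and> S \<subseteq> D \<and> (\<forall>v\<in>S. 0 \<le> c v)}"

definition nonstationary ::
    "(real ^ 'n \<Rightarrow> real ^ 'n) \<Rightarrow> (real ^ 'n) set \<Rightarrow> real ^ 'n \<Rightarrow> bool" where
  "nonstationary g C x \<longleftrightarrow> (\<exists>d\<in>tangent_cone C x. g x \<bullet> d < 0)"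

(* Curves on [0,\<infinity>) are total functions on the reals; the values at negative arguments are
   unconstrained and irrelevant, continuity and derivative being taken within [0,\<infinity>). *)
definition feasible_search_path ::
    "(real ^ 'n) set \<Rightarrow> real ^ 'n \<Rightarrow> (real \<Rightarrow> real ^ 'n) \<Rightarrow> bool" where
  "feasible_search_path C x \<gamma> \<longleftrightarrow>
     \<gamma> ` {0..} \<subseteq> C \<and> continuous_on {0..} \<gamma> \<and> \<gamma> 0 = x \<and>
     \<gamma> differentiable (at 0 within {0..})"

definition initial_velocity :: "(real \<Rightarrow> real ^ 'n) \<Rightarrow> real ^ 'n" where
  "initial_velocity \<gamma> = vector_derivative \<gamma> (at 0 within {0..})"

end

theory Submission
  imports Defs
begin

text \<open>Since \<open>\<nabla>f(xbar)\<^sup>Td < 0\<close> for some \<open>d\<close> in the cone generated by the initial velocities, already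
  one initial velocity \<open>v\<close> satisfies \<open>\<nabla>f(xbar)\<^sup>Tv < 0\<close>.  Along the corresponding path, \<open>f\<close> decreases
  to first order in \<open>t\<close>, which dominates \<open>\<sigma>t\<^sup>2\<close>.\<close>

text \<open>By contraposition: the set of all \<open>v\<close> with
  \<open>0 \<le> a \<bullet> v\<close> is closed under nonnegative combinations, so it contains the
  generated cone once it contains \<open>D\<close>.\<close>

lemma generated_cone_negative_generator:
  fixes a d :: "real ^ 'n"
  assumes "d \<in> generated_cone D" "a \<bullet> d < 0"
  shows "\<exists>v\<in>D. a \<bullet> v < 0"
proof (rule ccontr)
  assume "\<not> ?thesis"
  then have nonneg: "0 \<le> a \<bullet> v" if "v \<in> D" for v
    using that by force
  from assms(1) obtain S c where "S \<subseteq> D" "\<forall>v\<in>S. 0 \<le> c v" "d = (\<Sum>v\<in>S. c v *\<^sub>R v)"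
    unfolding generated_cone_def by blast
  then have "0 \<le> a \<bullet> d"
    by (auto simp: inner_sum_right intro!: sum_nonneg mult_nonneg_nonneg nonneg)
  with assms(2) show False by simp
qed

text \<open>Chain rule at the endpoint of the half-line, which reduces the decrease of
  \<open>f\<close> along a path to a statement about a real function of one variable.\<close>

lemma has_real_derivative_along_path:
  fixes C :: "(real ^ 'n) set"
  assumes "has_continuous_gradient_on f g C" "x \<in> C" "feasible_search_path C x \<gamma>"
  shows "((\<lambda>t. f (\<gamma> t)) has_real_derivative g x \<bullet> initial_velocity \<gamma>) (at 0 within {0..})"
proof -
  have path: "\<gamma> ` {0..} \<subseteq> C" "\<gamma> 0 = x" "\<gamma> differentiable (at 0 within {0..})"
    using assms(3) by (auto simp: feasible_search_path_def)
  \<comment> \<open>The chain rule asks for the derivative of \<open>f\<close> within the image of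
    the path; it is inherited from the larger set \<open>C\<close>.\<close>
  have "(f has_derivative (\<lambda>h. g x \<bullet> h)) (at (\<gamma> 0) within \<gamma> ` {0..})"
    using assms(1,2) path by (auto simp: has_continuous_gradient_on_def intro: has_derivative_subset)
  moreover have "(\<gamma> has_derivative (\<lambda>t. t *\<^sub>R initial_velocity \<gamma>)) (at 0 within {0..})"
    using path(3) unfolding initial_velocity_def vector_derivative_works
    by (simp add: has_vector_derivative_def)
  ultimately have "(f \<circ> \<gamma> has_derivative (\<lambda>h. g x \<bullet> h) \<circ> (\<lambda>t. t *\<^sub>R initial_velocity \<gamma>))
      (at 0 within {0..})"
    by (rule diff_chain_within[rotated])
  then show ?thesis
    by (simp add: has_field_derivative_def o_def mult_commute_abs)
qed

text \<open>The term \<open>\<sigma> * t\<^sup>2\<close> has derivative zero at 0, so adding it to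
  \<open>\<phi>\<close> keeps the negative slope, and the sum drops strictly below its initial value
  just to the right of 0.\<close>

lemma negative_derivative_quadratic_decrease:
  fixes \<phi> :: "real \<Rightarrow> real"
  assumes "(\<phi> has_real_derivative D) (at 0 within {0..})" "D < 0"
  shows "\<exists>tbar>0. \<forall>t\<in>{0<..tbar}. \<phi> t - \<phi> 0 < - \<sigma> * t\<^sup>2"
proof -
  have "((\<lambda>t. \<phi> t + \<sigma> * t\<^sup>2) has_real_derivative D) (at 0 within {0..})"
    using assms(1) by (auto intro!: derivative_eq_intros)
  from has_real_derivative_neg_dec_right[OF this \<open>D < 0\<close>] obtain e
    where e: "e > 0" "\<And>h. 0 < h \<Longrightarrow> h < e \<Longrightarrow> \<phi> h + \<sigma> * h\<^sup>2 < \<phi> 0"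
    by auto
  \<comment> \<open>The decrease is known on the open interval from 0 to \<open>e\<close>; halving
    \<open>e\<close> makes the right endpoint admissible.\<close>
  have "\<phi> t - \<phi> 0 < - \<sigma> * t\<^sup>2" if "t \<in> {0<..e/2}" for t
    using e(2)[of t] e(1) that by auto
  then show ?thesis
    using e(1) by (intro exI[of _ "e/2"]) auto
qed

theorem proposition3p2:
  fixes C :: "(real ^ 'n) set"
    and f :: "real ^ 'n \<Rightarrow> real"
    and grad_f :: "real ^ 'n \<Rightarrow> real ^ 'n"
    and xbar :: "real ^ 'n"
    and \<Gamma> :: "(real \<Rightarrow> real ^ 'n) set"
    and \<sigma> :: real
  assumes "convex C"
    and "has_continuous_gradient_on f grad_f C"
    and "xbar \<in> C"
    and "nonstationary grad_f C xbar"
    and "polyhedron (tangent_cone C xbar)"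
    and "\<forall>\<gamma>\<in>\<Gamma>. feasible_search_path C xbar \<gamma>"
    and "generated_cone (initial_velocity ` \<Gamma>) = tangent_cone C xbar"
    and "\<sigma> > 0"
  shows "\<exists>\<gamma>\<in>\<Gamma>. \<exists>tbar>0. \<forall>t\<in>{0<..tbar}.
           f (\<gamma> t) - f (\<gamma> 0) < - \<sigma> * t\<^sup>2 \<and> - \<sigma> * t\<^sup>2 < 0"
proof -
  from assms(4) obtain d where "d \<in> tangent_cone C xbar" "grad_f xbar \<bullet> d < 0"
    unfolding nonstationary_def by blast
  then have "\<exists>v\<in>initial_velocity ` \<Gamma>. grad_f xbar \<bullet> v < 0"
    using assms(7) by (intro generated_cone_negative_generator[of d]) simp_all
  then obtain \<gamma> where \<gamma>: "\<gamma> \<in> \<Gamma>" "grad_f xbar \<bullet> initial_velocity \<gamma> < 0"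
    by blast
  from \<gamma>(1) assms(6) have "feasible_search_path C xbar \<gamma>" by blast
  from negative_derivative_quadratic_decrease
      [OF has_real_derivative_along_path[OF assms(2,3) this] \<gamma>(2), of \<sigma>]
  obtain tbar where "tbar > 0" "\<forall>t\<in>{0<..tbar}. f (\<gamma> t) - f (\<gamma> 0) < - \<sigma> * t\<^sup>2"
    by blast
  \<comment> \<open>Positivity of \<open>\<sigma>\<close> and \<open>t\<close> gives the second
    inequality, \<open>- \<sigma> * t\<^sup>2 < 0\<close>.\<close>
  with \<gamma>(1) \<open>\<sigma> > 0\<close> show ?thesis
    by (intro bexI[of _ \<gamma>] exI[of _ tbar]) auto
qed

end
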